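(* Let $r^*=(r^{L,*},r^{F_1,*},r^{F_2,*})$ be a reward structure and $\delta^*\in\Pi$ a finite-memory policy tuple with $\alpha^{1,0}_{\delta^*}<0$ and $\alpha^{0,1}_{\delta^*}<0$ (componentwise; computed with $r^*$), and let $h_1=|\max_\zeta\alpha^{1,0}_{\delta^*}(\zeta)|$ and $h_2=|\max_\zeta\alpha^{0,1}_{\delta^*}(\zeta)|$. Let $$\eta^1=\|\alpha^{1,0}_{\delta^*}\|+\Big\|\sum_{z^{F_1}\ne s^L_2}\sigma_{s^L_2,z^{F_1}}\alpha^{0,0}_{\delta^*}(\bar\zeta(s,z^{F_1},s^L_1,\zeta,\delta^*(\zeta)))-\alpha^{0,0}_{\delta^*}(\bar\zeta(s,s^L_2,s^L_1,\zeta,\delta^*(\zeta)))\Big\|,$$ $$\eta^2=\|\alpha^{0,1}_{\delta^*}\|+\Big\|\sum_{z^{F_2}\ne s^L_1}\sigma_{s^L_1,z^{F_2}}\alpha^{0,0}_{\delta^*}(\bar\zeta(s,s^L_2,z^{F_2},\zeta,\delta^*(\zeta)))-\alpha^{0,0}_{\delta^*}(\bar\zeta(s,s^L_2,s^L_1,\zeta,\delta^*(\zeta)))\Big\|.$$ Then, for any finite-memory policy tuple $\delta\in\Pi$ (and reward structure $r=(r^L,r^{F_1},r^{F_2})$, with which $\alpha_\delta$ is computed), $\alpha^{1,0}_\delta,\alpha^{0,1}_\delta\le 0$ if the following two conditions are satisfied: $$d(\delta,\delta^* )\eta^1+\Big\|\sum_{z^{F_1}\ne s^L_2}\sigma_{s^L_2,z^{F_1}}\big[\alpha^{0,0}_{\delta^*}(\bar\zeta(s,z^{F_1},s^L_1,\zeta,\delta(\zeta)))-\alpha^{0,0}_{\delta}(\bar\zeta(s,z^{F_1},s^L_1,\zeta,\delta(\zeta)))\big]\Big\|+\Big\|\alpha^{0,0}_{\delta^*}(\bar\zeta(s,s^L_2,s^L_1,\zeta,\delta(\zeta)))-\alpha^{0,0}_{\delta}(\bar\zeta(s,s^L_2,s^L_1,\zeta,\delta(\zeta)))\Big\|\le\frac{1-\beta}{\beta}h_1,$$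 $$d(\delta,\delta^* )\eta^2+\Big\|\sum_{z^{F_2}\ne s^L_1}\sigma_{s^L_1,z^{F_2}}\big[\alpha^{0,0}_{\delta^*}(\bar\zeta(s,s^L_2,z^{F_2},\zeta,\delta(\zeta)))-\alpha^{0,0}_{\delta}(\bar\zeta(s,s^L_2,z^{F_2},\zeta,\delta(\zeta)))\big]\Big\|+\Big\|\alpha^{0,0}_{\delta^*}(\bar\zeta(s,s^L_2,s^L_1,\zeta,\delta(\zeta)))-\alpha^{0,0}_{\delta}(\bar\zeta(s,s^L_2,s^L_1,\zeta,\delta(\zeta)))\Big\|\le\frac{1-\beta}{\beta}h_2.$$
   Context: Game. There are three agents: a leader $L$ and two followers $F_1,F_2$; time is $t=0,1,2,\dots$. The finite state spaces are $S^L=S^L_1\times S^L_2$, $S^{F_1}$, $S^{F_2}$; put $S^F=S^{F_1}\times S^{F_2}$, $S=S^L\times S^F$, and write a state as $s=(s^L_1,s^L_2,s^F)$. The action spaces $A^L,A^{F_1},A^{F_2}$ are finite and $a=(a^L,a^{F_1},a^{F_2})$ is a joint action. The state evolves according to given probabilities $P(s'|s,a)$. The discount factor is $\beta\in(0,1)$ and agent $k$ receives reward $r^k(s,a)$ at each time. Messages. The leader observes the full state. Follower $i$ observes $s^L_i$ and $s^F$ exactly, and learns about $s^L_{3-i}$ only via a message $z^{F_i}\in Z^{F_i}:=S^L_{3-i}$, equal to $s^L_{3-i}$ with probability $1-\epsilon_i$ and equal to $z\neq s^L_{3-i}$ with probability $\epsilon_i\sigma_{s^L_{3-i},z}$ (independently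 across $i$ given the current state), where $\sigma_{s,z}\ge0$, $\sigma_{s,s}=0$, $\sum_z\sigma_{s,z}=1$ are fixed. Histories and policies. Set $\bar z^L=s^F$, $\bar z^{F_i}=(s^L_i,z^{F_i},s^{F_{3-i}})$. For a fixed memory length $\tau$, agent $k$'s information history is $\zeta^k=\{s^k(t),\dots,s^k(t-\tau+1),\bar z^k(t),\dots,\bar z^k(t-\tau+1),a^k(t-1),\dots,a^k(t-\tau)\}$; a joint history is $\zeta=(\zeta^L,\zeta^{F_1},\zeta^{F_2})$ and $\{\zeta\}$ is the set of these; the current state $s$ is determined by $\zeta$. A finite-memory policy $\delta^k$ chooses $a^k$ on the basis of $\zeta^k$, according to $P(a^k|\zeta^k)$; $\Pi$ is the set of tuples $\delta=(\delta^L,\delta^{F_1},\delta^{F_2})$ of such policies, $P(a|\zeta)=\prod_kP(a^k|\zeta^k)$ and $\delta(\zeta)$ denotes the resulting joint action. $\bar\zeta(s',z_1,z_2,\zeta,a)$ is the updated joint history when, after joint history $\zeta$ and joint action $a$, the next state is $s'$ and followers 1 and 2 receive messages $z_1,z_2$. Thus $\bar\zeta(s',s'^L_2,s'^L_1,\zeta,a)$ corresponds to accurate messages to both. For randomized policies, $\sum_{s'}P(s'|s,\delta(\zeta))f(\bar\zeta(s',\cdot,\cdot,\zeta,\delta(\zeta)))$ means $\sum_aP(a|\zeta)\sum_{s'}P(s'|s,a)f(\bar\zeta(s',\cdot,\cdot,\zeta,a))$. Vectors $\alpha_\delta$. Let $R^L_\delta(\zeta)=\sum_ar^L(s,a)P(a|\zeta)$.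 For $f$ on $\{\zeta\}$ let $\Lambda f(\zeta)=\beta\sum_{s'}P(s'|s,\delta(\zeta))f(\bar\zeta(s',s'^L_2,s'^L_1,\zeta,\delta(\zeta)))$, $\Delta f(\zeta)=-\Lambda f(\zeta)+\beta\sum_{s'}P(s'|s,\delta(\zeta))\sum_{z\ne s'^L_2}\sigma_{s'^L_2,z}f(\bar\zeta(s',z,s'^L_1,\zeta,\delta(\zeta)))$, $\bar\Delta f(\zeta)=-\Lambda f(\zeta)+\beta\sum_{s'}P(s'|s,\delta(\zeta))\sum_{z\ne s'^L_1}\sigma_{s'^L_1,z}f(\bar\zeta(s',s'^L_2,z,\zeta,\delta(\zeta)))$. Then $\alpha^{0,0}_\delta,\alpha^{1,0}_\delta,\alpha^{0,1}_\delta$ are the unique solutions of $\alpha^{0,0}=R^L_\delta+\Lambda\alpha^{0,0}$, $\alpha^{1,0}=\Delta\alpha^{0,0}+\Lambda\alpha^{1,0}$, $\alpha^{0,1}=\bar\Delta\alpha^{0,0}+\Lambda\alpha^{0,1}$. (They are the coefficients of $1,\epsilon_1,\epsilon_2$ in the power series expansion of the leader's value in $(\epsilon_1,\epsilon_2)$.) Norm and distance. $\|u\|=\max_\zeta|u(\zeta)|$ for a function $u$ on $\{\zeta\}$; the norm of an expression depending on $\zeta$, on a (next) state $s$ and on $\delta(\zeta)$ is the maximum of its absolute value over all $\zeta$ and $s$ (and, for randomized policies, over all $a$ with $P(a|\zeta)>0$). $U$ is the set of bounded real-valued functions on $\{\zeta\}$ and $$d(\delta,\delta')=\sup_{u\in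 U,\|u\|\le1}\Big\|\sum_{s'}P(s'|s,\delta(\zeta))u(\bar\zeta(s',s'^L_2,s'^L_1,\zeta,\delta(\zeta)))-\sum_{s'}P(s'|s,\delta'(\zeta))u(\bar\zeta(s',s'^L_2,s'^L_1,\zeta,\delta'(\zeta)))\Big\|.$$ Inequalities between vectors are componentwise.
   Formalization: In η¹ and η² the second norm is taken over all actions having positive probability under δ* or under δ, not under δ* alone; with δ*'s actions only, the claim fails for randomized δ taking actions that δ* never takes. *)

theory Defs
  imports "HOL-Probability.Probability"
begin

text \<open>
  A state is \<open>((s\<^sup>L\<^sub>1, s\<^sup>L\<^sub>2), (s\<^sup>F\<^sup>1, s\<^sup>F\<^sup>2))\<close> and a joint action is
  \<open>(a\<^sup>L, a\<^sup>F\<^sup>1, a\<^sup>F\<^sup>2)\<close>.  The finite state and action spaces are types of class \<open>finite\<close>.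
\<close>

type_synonym ('s1, 's2, 'f1, 'f2) state = "('s1 \<times> 's2) \<times> ('f1 \<times> 'f2)"
type_synonym ('aL, 'a1, 'a2) action = "'aL \<times> 'a1 \<times> 'a2"

definition lead1 :: "('s1, 's2, 'f1, 'f2) state \<Rightarrow> 's1" where
  "lead1 s = fst (fst s)"

definition lead2 :: "('s1, 's2, 'f1, 'f2) state \<Rightarrow> 's2" where
  "lead2 s = snd (fst s)"

text \<open>
  \<open>sig1 G\<close> is the distribution of an inaccurate message to follower 1, a message about
  \<open>s\<^sup>L\<^sub>2\<close>; \<open>sig2 G\<close> is that of an inaccurate message to follower 2, a message about \<open>s\<^sup>L\<^sub>1\<close>.
  The error probabilities \<open>\<epsilon>\<^sub>1\<close>, \<open>\<epsilon>\<^sub>2\<close> do not enter the expansion coefficients defined below.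
\<close>

record ('s1, 's2, 'f1, 'f2, 'aL, 'a1, 'a2) game =
  trans :: "('s1, 's2, 'f1, 'f2) state \<Rightarrow> ('aL, 'a1, 'a2) action \<Rightarrow> ('s1, 's2, 'f1, 'f2) state pmf"
  sig1 :: "'s2 \<Rightarrow> 's2 pmf"
  sig2 :: "'s1 \<Rightarrow> 's1 pmf"
  discount :: real
  memlen :: nat

definition wf_game ::
    "('s1::finite, 's2::finite, 'f1::finite, 'f2::finite, 'aL::finite, 'a1::finite, 'a2::finite) game \<Rightarrow> bool"
  where
  "wf_game G \<longleftrightarrow>
     0 < discount G \<and> discount G < 1 \<and> 1 \<le> memlen G \<and>
     (\<forall>s. pmf (sig1 G s) s = 0) \<and> (\<forall>s. pmf (sig2 G s) s = 0)"

text \<open>Rewards \<open>(r\<^sup>L, r\<^sup>F\<^sup>1, r\<^sup>F\<^sup>2)\<close>.\<close>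

type_synonym ('s1, 's2, 'f1, 'f2, 'aL, 'a1, 'a2) reward =
  "('s1, 's2, 'f1, 'f2) state \<Rightarrow> ('aL, 'a1, 'a2) action \<Rightarrow> real"

type_synonym ('s1, 's2, 'f1, 'f2, 'aL, 'a1, 'a2) reward_structure =
  "('s1, 's2, 'f1, 'f2, 'aL, 'a1, 'a2) reward \<times>
   ('s1, 's2, 'f1, 'f2, 'aL, 'a1, 'a2) reward \<times>
   ('s1, 's2, 'f1, 'f2, 'aL, 'a1, 'a2) reward"

text \<open>
  A joint history lists, most recent first, the entries
  \<open>(s(u), z\<^sup>F\<^sup>1(u), z\<^sup>F\<^sup>2(u), a(u - 1))\<close> for \<open>u = t, ..., t - \<tau> + 1\<close>.  The three agents' information
  histories are its projections below; together they determine it, so these lists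
  correspond one-to-one to the triples \<open>(\<zeta>\<^sup>L, \<zeta>\<^sup>F\<^sup>1, \<zeta>\<^sup>F\<^sup>2)\<close> that arise from a common sequence of
  states, messages and actions.
\<close>

type_synonym ('s1, 's2, 'f1, 'f2, 'aL, 'a1, 'a2) history =
  "(('s1, 's2, 'f1, 'f2) state \<times> 's2 \<times> 's1 \<times> ('aL, 'a1, 'a2) action) list"

type_synonym ('s1, 's2, 'f1, 'f2, 'aL) historyL = "(('s1 \<times> 's2) \<times> ('f1 \<times> 'f2) \<times> 'aL) list"
type_synonym ('s1, 's2, 'f1, 'f2, 'a1) historyF1 = "('f1 \<times> ('s1 \<times> 's2 \<times> 'f2) \<times> 'a1) list"
type_synonym ('s1, 's2, 'f1, 'f2, 'a2) historyF2 = "('f2 \<times> ('s2 \<times> 's1 \<times> 'f1) \<times> 'a2) list"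

definition viewL ::
    "('s1, 's2, 'f1, 'f2, 'aL, 'a1, 'a2) history \<Rightarrow> ('s1, 's2, 'f1, 'f2, 'aL) historyL" where
  "viewL = map (\<lambda>((sL, sF), z1, z2, (aL, a1, a2)). (sL, sF, aL))"

definition viewF1 ::
    "('s1, 's2, 'f1, 'f2, 'aL, 'a1, 'a2) history \<Rightarrow> ('s1, 's2, 'f1, 'f2, 'a1) historyF1" where
  "viewF1 = map (\<lambda>(((sL1, sL2), (f1, f2)), z1, z2, (aL, a1, a2)). (f1, (sL1, z1, f2), a1))"

definition viewF2 ::
    "('s1, 's2, 'f1, 'f2, 'aL, 'a1, 'a2) history \<Rightarrow> ('s1, 's2, 'f1, 'f2, 'a2) historyF2" where
  "viewF2 = map (\<lambda>(((sL1, sL2), (f1, f2)), z1, z2, (aL, a1, a2)). (f2, (sL2, z2, f1), a2))"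

definition histories ::
    "('s1, 's2, 'f1, 'f2, 'aL, 'a1, 'a2) game \<Rightarrow> ('s1, 's2, 'f1, 'f2, 'aL, 'a1, 'a2) history set" where
  "histories G = {\<zeta>. length \<zeta> = memlen G}"

definition cur_state ::
    "('s1, 's2, 'f1, 'f2, 'aL, 'a1, 'a2) history \<Rightarrow> ('s1, 's2, 'f1, 'f2) state" where
  "cur_state \<zeta> = fst (hd \<zeta>)"

text \<open>\<open>upd G s' z\<^sub>1 z\<^sub>2 \<zeta> a\<close> is the updated history \<open>\<zeta>\<close>-bar of arguments \<open>(s', z\<^sub>1, z\<^sub>2, \<zeta>, a)\<close>.\<close>

definition upd ::
    "('s1, 's2, 'f1, 'f2, 'aL, 'a1, 'a2) game \<Rightarrow> ('s1, 's2, 'f1, 'f2) state \<Rightarrow> 's2 \<Rightarrow> 's1 \<Rightarrow>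
     ('s1, 's2, 'f1, 'f2, 'aL, 'a1, 'a2) history \<Rightarrow> ('aL, 'a1, 'a2) action \<Rightarrow>
     ('s1, 's2, 'f1, 'f2, 'aL, 'a1, 'a2) history" where
  "upd G s' z1 z2 \<zeta> a = take (memlen G) ((s', z1, z2, a) # \<zeta>)"

type_synonym ('s1, 's2, 'f1, 'f2, 'aL, 'a1, 'a2) policy =
  "(('s1, 's2, 'f1, 'f2, 'aL) historyL \<Rightarrow> 'aL pmf) \<times>
   (('s1, 's2, 'f1, 'f2, 'a1) historyF1 \<Rightarrow> 'a1 pmf) \<times>
   (('s1, 's2, 'f1, 'f2, 'a2) historyF2 \<Rightarrow> 'a2 pmf)"

text \<open>
  \<open>pmf (act \<delta> \<zeta>) a\<close> is the product \<open>P(a|\<zeta>)\<close> of the three agents' action probabilities.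
\<close>

definition act ::
    "('s1, 's2, 'f1, 'f2, 'aL, 'a1, 'a2) policy \<Rightarrow> ('s1, 's2, 'f1, 'f2, 'aL, 'a1, 'a2) history \<Rightarrow>
     ('aL, 'a1, 'a2) action pmf" where
  "act = (\<lambda>(\<delta>L, \<delta>1, \<delta>2) \<zeta>.
     pair_pmf (\<delta>L (viewL \<zeta>)) (pair_pmf (\<delta>1 (viewF1 \<zeta>)) (\<delta>2 (viewF2 \<zeta>))))"

text \<open>\<open>expect_next G \<delta> \<zeta> F\<close> is the sum of \<open>P(a|\<zeta>) P(s'|s,a) F(s',a)\<close> over \<open>a\<close> and \<open>s'\<close>.\<close>

definition expect_next ::
    "('s1::finite, 's2::finite, 'f1::finite, 'f2::finite, 'aL::finite, 'a1::finite, 'a2::finite) game \<Rightarrow>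
     ('s1, 's2, 'f1, 'f2, 'aL, 'a1, 'a2) policy \<Rightarrow> ('s1, 's2, 'f1, 'f2, 'aL, 'a1, 'a2) history \<Rightarrow>
     (('s1, 's2, 'f1, 'f2) state \<Rightarrow> ('aL, 'a1, 'a2) action \<Rightarrow> real) \<Rightarrow> real" where
  "expect_next G \<delta> \<zeta> F =
     (\<Sum>a\<in>UNIV. pmf (act \<delta> \<zeta>) a * (\<Sum>s'\<in>UNIV. pmf (trans G (cur_state \<zeta>) a) s' * F s' a))"

text \<open>
  \<open>f\<close> at the history following \<open>\<zeta>\<close>, \<open>a\<close> and next state \<open>s'\<close>: with accurate messages (\<open>acc\<close>),
  and averaged over an inaccurate message to follower 1 only (\<open>inacc1\<close>) or to follower 2
  only (\<open>inacc2\<close>).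
\<close>

definition acc ::
    "('s1, 's2, 'f1, 'f2, 'aL, 'a1, 'a2) game \<Rightarrow>
     (('s1, 's2, 'f1, 'f2, 'aL, 'a1, 'a2) history \<Rightarrow> real) \<Rightarrow>
     ('s1, 's2, 'f1, 'f2, 'aL, 'a1, 'a2) history \<Rightarrow> ('s1, 's2, 'f1, 'f2) state \<Rightarrow>
     ('aL, 'a1, 'a2) action \<Rightarrow> real" where
  "acc G f \<zeta> s' a = f (upd G s' (lead2 s') (lead1 s') \<zeta> a)"

definition inacc1 ::
    "('s1, 's2::finite, 'f1, 'f2, 'aL, 'a1, 'a2) game \<Rightarrow>
     (('s1, 's2, 'f1, 'f2, 'aL, 'a1, 'a2) history \<Rightarrow> real) \<Rightarrow>
     ('s1, 's2, 'f1, 'f2, 'aL, 'a1, 'a2) history \<Rightarrow> ('s1, 's2, 'f1, 'f2) state \<Rightarrow>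
     ('aL, 'a1, 'a2) action \<Rightarrow> real" where
  "inacc1 G f \<zeta> s' a =
     (\<Sum>z\<in>UNIV - {lead2 s'}. pmf (sig1 G (lead2 s')) z * f (upd G s' z (lead1 s') \<zeta> a))"

definition inacc2 ::
    "('s1::finite, 's2, 'f1, 'f2, 'aL, 'a1, 'a2) game \<Rightarrow>
     (('s1, 's2, 'f1, 'f2, 'aL, 'a1, 'a2) history \<Rightarrow> real) \<Rightarrow>
     ('s1, 's2, 'f1, 'f2, 'aL, 'a1, 'a2) history \<Rightarrow> ('s1, 's2, 'f1, 'f2) state \<Rightarrow>
     ('aL, 'a1, 'a2) action \<Rightarrow> real" where
  "inacc2 G f \<zeta> s' a =
     (\<Sum>z\<in>UNIV - {lead1 s'}. pmf (sig2 G (lead1 s')) z * f (upd G s' (lead2 s') z \<zeta> a))"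

definition reward_of ::
    "('s1::finite, 's2::finite, 'f1::finite, 'f2::finite, 'aL::finite, 'a1::finite, 'a2::finite) reward_structure \<Rightarrow>
     ('s1, 's2, 'f1, 'f2, 'aL, 'a1, 'a2) policy \<Rightarrow>
     ('s1, 's2, 'f1, 'f2, 'aL, 'a1, 'a2) history \<Rightarrow> real" where
  "reward_of r \<delta> \<zeta> = (\<Sum>a\<in>UNIV. fst r (cur_state \<zeta>) a * pmf (act \<delta> \<zeta>) a)"

definition Lam ::
    "('s1::finite, 's2::finite, 'f1::finite, 'f2::finite, 'aL::finite, 'a1::finite, 'a2::finite) game \<Rightarrow>
     ('s1, 's2, 'f1, 'f2, 'aL, 'a1, 'a2) policy \<Rightarrow>
     (('s1, 's2, 'f1, 'f2, 'aL, 'a1, 'a2) history \<Rightarrow> real) \<Rightarrow>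
     ('s1, 's2, 'f1, 'f2, 'aL, 'a1, 'a2) history \<Rightarrow> real" where
  "Lam G \<delta> f \<zeta> = discount G * expect_next G \<delta> \<zeta> (acc G f \<zeta>)"

definition Del1 ::
    "('s1::finite, 's2::finite, 'f1::finite, 'f2::finite, 'aL::finite, 'a1::finite, 'a2::finite) game \<Rightarrow>
     ('s1, 's2, 'f1, 'f2, 'aL, 'a1, 'a2) policy \<Rightarrow>
     (('s1, 's2, 'f1, 'f2, 'aL, 'a1, 'a2) history \<Rightarrow> real) \<Rightarrow>
     ('s1, 's2, 'f1, 'f2, 'aL, 'a1, 'a2) history \<Rightarrow> real" where
  "Del1 G \<delta> f \<zeta> = - Lam G \<delta> f \<zeta> + discount G * expect_next G \<delta> \<zeta> (inacc1 G f \<zeta>)"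

definition Del2 ::
    "('s1::finite, 's2::finite, 'f1::finite, 'f2::finite, 'aL::finite, 'a1::finite, 'a2::finite) game \<Rightarrow>
     ('s1, 's2, 'f1, 'f2, 'aL, 'a1, 'a2) policy \<Rightarrow>
     (('s1, 's2, 'f1, 'f2, 'aL, 'a1, 'a2) history \<Rightarrow> real) \<Rightarrow>
     ('s1, 's2, 'f1, 'f2, 'aL, 'a1, 'a2) history \<Rightarrow> real" where
  "Del2 G \<delta> f \<zeta> = - Lam G \<delta> f \<zeta> + discount G * expect_next G \<delta> \<zeta> (inacc2 G f \<zeta>)"

text \<open>
  The solution \<open>f\<close> of \<open>f = g + Lam G \<delta> f\<close> on the set of histories.  Lists of another length
  than the memory length are no histories; \<open>extensional\<close> pins the value of \<open>f\<close> there.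
\<close>

definition Lam_solution ::
    "('s1::finite, 's2::finite, 'f1::finite, 'f2::finite, 'aL::finite, 'a1::finite, 'a2::finite) game \<Rightarrow>
     ('s1, 's2, 'f1, 'f2, 'aL, 'a1, 'a2) policy \<Rightarrow>
     (('s1, 's2, 'f1, 'f2, 'aL, 'a1, 'a2) history \<Rightarrow> real) \<Rightarrow>
     ('s1, 's2, 'f1, 'f2, 'aL, 'a1, 'a2) history \<Rightarrow> real" where
  "Lam_solution G \<delta> g =
     (THE f. f \<in> extensional (histories G) \<and> (\<forall>\<zeta>\<in>histories G. f \<zeta> = g \<zeta> + Lam G \<delta> f \<zeta>))"

lemma finite_histories: "finite (histories G)"
  for G :: "('s1::finite, 's2::finite, 'f1::finite, 'f2::finite, 'aL::finite, 'a1::finite, 'a2::finite) game"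
  unfolding histories_def
  by (rule finite_lists_length_eq[OF finite_class.finite_UNIV, simplified])

lemma histories_nonempty: "histories G \<noteq> {}"
proof -
  have "replicate (memlen G) undefined \<in> histories G"
    by (simp add: histories_def)
  then show ?thesis by blast
qed

lemma upd_in_histories: "\<zeta> \<in> histories G \<Longrightarrow> upd G s' z1 z2 \<zeta> a \<in> histories G"
  by (simp add: histories_def upd_def)

lemma acc_cong:
  assumes "\<zeta> \<in> histories G" "\<And>\<xi>. \<xi> \<in> histories G \<Longrightarrow> f \<xi> = g \<xi>"
  shows "acc G f \<zeta> = acc G g \<zeta>"
  using assms by (simp add: acc_def fun_eq_iff upd_in_histories)

lemma abs_expect_next_le:
  assumes "\<And>s' a. \<bar>F s' a\<bar> \<le> c"
  shows "\<bar>expect_next G \<delta> \<zeta> F\<bar> \<le> c"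
proof -
  have pmf1: "(\<Sum>x\<in>UNIV. pmf p x) = 1" for p :: "'x::finite pmf"
    by (rule sum_pmf_eq_1) auto
  have "\<bar>expect_next G \<delta> \<zeta> F\<bar>
      \<le> (\<Sum>a\<in>UNIV. pmf (act \<delta> \<zeta>) a * (\<Sum>s'\<in>UNIV. pmf (trans G (cur_state \<zeta>) a) s' * c))"
    unfolding expect_next_def
    by (intro order_trans[OF sum_abs] sum_mono)
       (auto simp: abs_mult intro!: mult_left_mono order_trans[OF sum_abs] sum_mono assms)
  also have "\<dots> = c"
    by (simp add: pmf1 flip: sum_distrib_right)
  finally show ?thesis .
qed

lemma abs_Lam_le:
  assumes "wf_game G" "\<zeta> \<in> histories G" "\<And>\<xi>. \<xi> \<in> histories G \<Longrightarrow> \<bar>f \<xi>\<bar> \<le> c"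
  shows "\<bar>Lam G \<delta> f \<zeta>\<bar> \<le> discount G * c"
proof -
  have "\<bar>expect_next G \<delta> \<zeta> (acc G f \<zeta>)\<bar> \<le> c"
    by (rule abs_expect_next_le) (simp add: acc_def assms upd_in_histories)
  then show ?thesis
    using assms(1) by (simp add: Lam_def wf_game_def abs_mult)
qed

lemma Lam_diff: "Lam G \<delta> (\<lambda>\<xi>. f \<xi> - g \<xi>) \<zeta> = Lam G \<delta> f \<zeta> - Lam G \<delta> g \<zeta>"
  by (simp add: Lam_def expect_next_def acc_def right_diff_distrib sum_subtractf)

lemma Lam_cong:
  assumes "\<zeta> \<in> histories G" "\<And>\<xi>. \<xi> \<in> histories G \<Longrightarrow> f \<xi> = g \<xi>"
  shows "Lam G \<delta> f \<zeta> = Lam G \<delta> g \<zeta>"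
  unfolding Lam_def by (simp only: acc_cong[OF assms])

lemma Lam_sums:
  assumes "\<zeta> \<in> histories G" "\<And>\<xi>. \<xi> \<in> histories G \<Longrightarrow> (\<lambda>n. h n \<xi>) sums f \<xi>"
  shows "(\<lambda>n. Lam G \<delta> (h n) \<zeta>) sums Lam G \<delta> f \<zeta>"
  unfolding Lam_def expect_next_def acc_def
  by (intro sums_mult sums_sum assms upd_in_histories)

lemma Lam_fixpoint_ex1:
  assumes wf: "wf_game G"
  shows "\<exists>!f. f \<in> extensional (histories G) \<and> (\<forall>\<zeta>\<in>histories G. f \<zeta> = g \<zeta> + Lam G \<delta> f \<zeta>)"
proof (rule ex_ex1I)
  let ?b = "discount G" and ?H = "histories G"
  have b: "0 < ?b" "?b < 1" using wf by (auto simp: wf_game_def)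
  define h where "h n = (Lam G \<delta> ^^ n) g" for n
  obtain c where c: "\<And>\<xi>. \<xi> \<in> ?H \<Longrightarrow> \<bar>g \<xi>\<bar> \<le> c"
    using finite_imp_bounded[OF finite_imageI[OF finite_histories[of G], of g]]
    by (auto simp: bounded_iff)
  have le: "\<xi> \<in> ?H \<Longrightarrow> \<bar>h n \<xi>\<bar> \<le> ?b ^ n * c" for n \<xi>
  proof (induction n arbitrary: \<xi>)
    case 0
    then show ?case using c by (simp add: h_def)
  next
    case (Suc n)
    then have "\<bar>Lam G \<delta> (h n) \<xi>\<bar> \<le> ?b * (?b ^ n * c)"
      by (intro abs_Lam_le[OF wf])
    then show ?case by (simp add: h_def mult.assoc)
  qed
  have sm: "summable (\<lambda>n. h n \<xi>)" if "\<xi> \<in> ?H" for \<xi>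
  proof (rule summable_comparison_test')
    show "summable (\<lambda>n. ?b ^ n * c)"
      using b by (intro summable_mult2 summable_geometric) auto
    show "norm (h n \<xi>) \<le> ?b ^ n * c" if "n \<ge> 0" for n
      using le[OF \<open>\<xi> \<in> ?H\<close>] by simp
  qed
  define f where "f = restrict (\<lambda>\<xi>. \<Sum>n. h n \<xi>) ?H"
  have sf: "(\<lambda>n. h n \<xi>) sums f \<xi>" if "\<xi> \<in> ?H" for \<xi>
    using summable_sums[OF sm[OF that]] that by (simp add: f_def)
  have "f \<zeta> = g \<zeta> + Lam G \<delta> f \<zeta>" if \<zeta>: "\<zeta> \<in> ?H" for \<zeta>
  proof -
    have "(\<lambda>n. h (Suc n) \<zeta>) sums Lam G \<delta> f \<zeta>"
      using Lam_sums[OF \<zeta> sf] by (simp add: h_def)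
    then have "(\<lambda>n. h n \<zeta>) sums (Lam G \<delta> f \<zeta> + h 0 \<zeta>)"
      by (rule sums_Suc)
    with sf[OF \<zeta>] show ?thesis
      by (auto simp: h_def dest: sums_unique2)
  qed
  then show "\<exists>f. f \<in> extensional ?H \<and> (\<forall>\<zeta>\<in>?H. f \<zeta> = g \<zeta> + Lam G \<delta> f \<zeta>)"
    by (intro exI[of _ f]) (auto simp: f_def)
next
  let ?b = "discount G" and ?H = "histories G"
  fix f f'
  assume f: "f \<in> extensional ?H \<and> (\<forall>\<zeta>\<in>?H. f \<zeta> = g \<zeta> + Lam G \<delta> f \<zeta>)"
    and f': "f' \<in> extensional ?H \<and> (\<forall>\<zeta>\<in>?H. f' \<zeta> = g \<zeta> + Lam G \<delta> f' \<zeta>)"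
  have b: "?b < 1" using wf by (auto simp: wf_game_def)
  define m where "m = Max ((\<lambda>\<xi>. \<bar>f \<xi> - f' \<xi>\<bar>) ` ?H)"
  have m: "\<bar>f \<xi> - f' \<xi>\<bar> \<le> m" if "\<xi> \<in> ?H" for \<xi>
    unfolding m_def using that by (intro Max_ge finite_imageI finite_histories imageI)
  have "m \<in> (\<lambda>\<xi>. \<bar>f \<xi> - f' \<xi>\<bar>) ` ?H"
    unfolding m_def by (intro Max_in) (simp_all add: finite_histories histories_nonempty)
  then obtain \<zeta> where \<zeta>: "\<zeta> \<in> ?H" "m = \<bar>f \<zeta> - f' \<zeta>\<bar>" by auto
  then have "m = \<bar>Lam G \<delta> (\<lambda>\<xi>. f \<xi> - f' \<xi>) \<zeta>\<bar>"
    using bspec[OF conjunct2[OF f], of \<zeta>] bspec[OF conjunct2[OF f'], of \<zeta>]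
    by (simp add: Lam_diff)
  also have "\<dots> \<le> ?b * m"
    by (rule abs_Lam_le[OF wf \<zeta>(1) m])
  finally have "(1 - ?b) * m \<le> 0" by (simp add: algebra_simps)
  then have "m \<le> 0" using b by (simp add: mult_le_0_iff)
  then have "f \<xi> = f' \<xi>" if "\<xi> \<in> ?H" for \<xi>
    using m[OF that] by simp
  then show "f = f'"
    using f f' by (intro extensionalityI[of f ?H f']) auto
qed

definition alpha00 ::
    "('s1::finite, 's2::finite, 'f1::finite, 'f2::finite, 'aL::finite, 'a1::finite, 'a2::finite) game \<Rightarrow>
     ('s1, 's2, 'f1, 'f2, 'aL, 'a1, 'a2) reward_structure \<Rightarrow>
     ('s1, 's2, 'f1, 'f2, 'aL, 'a1, 'a2) policy \<Rightarrow>
     ('s1, 's2, 'f1, 'f2, 'aL, 'a1, 'a2) history \<Rightarrow> real" where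
  "alpha00 G r \<delta> = Lam_solution G \<delta> (reward_of r \<delta>)"

definition alpha10 ::
    "('s1::finite, 's2::finite, 'f1::finite, 'f2::finite, 'aL::finite, 'a1::finite, 'a2::finite) game \<Rightarrow>
     ('s1, 's2, 'f1, 'f2, 'aL, 'a1, 'a2) reward_structure \<Rightarrow>
     ('s1, 's2, 'f1, 'f2, 'aL, 'a1, 'a2) policy \<Rightarrow>
     ('s1, 's2, 'f1, 'f2, 'aL, 'a1, 'a2) history \<Rightarrow> real" where
  "alpha10 G r \<delta> = Lam_solution G \<delta> (Del1 G \<delta> (alpha00 G r \<delta>))"

definition alpha01 ::
    "('s1::finite, 's2::finite, 'f1::finite, 'f2::finite, 'aL::finite, 'a1::finite, 'a2::finite) game \<Rightarrow>
     ('s1, 's2, 'f1, 'f2, 'aL, 'a1, 'a2) reward_structure \<Rightarrow>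
     ('s1, 's2, 'f1, 'f2, 'aL, 'a1, 'a2) policy \<Rightarrow>
     ('s1, 's2, 'f1, 'f2, 'aL, 'a1, 'a2) history \<Rightarrow> real" where
  "alpha01 G r \<delta> = Lam_solution G \<delta> (Del2 G \<delta> (alpha00 G r \<delta>))"

definition hnorm ::
    "('s1, 's2, 'f1, 'f2, 'aL, 'a1, 'a2) game \<Rightarrow>
     (('s1, 's2, 'f1, 'f2, 'aL, 'a1, 'a2) history \<Rightarrow> real) \<Rightarrow> real" where
  "hnorm G u = Max ((\<lambda>\<zeta>. \<bar>u \<zeta>\<bar>) ` histories G)"

text \<open>
  Norm of an expression in a history \<open>\<zeta>\<close>, a next state \<open>s\<close> and an action \<open>a\<close>.  All next states
  count, whatever their probability; the action ranges over \<open>A \<zeta>\<close>, intended to be the set of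
  actions with positive probability given \<open>\<zeta>\<close>.  If two policies are compared through \<open>e\<close>, then
  \<open>A \<zeta>\<close> has to contain the actions of both: an action that only one of them takes may lead
  to histories at which \<open>e\<close> is arbitrarily larger, while the policies are close in \<open>pdist\<close>.
\<close>

definition enorm ::
    "('s1, 's2, 'f1, 'f2, 'aL, 'a1, 'a2) game \<Rightarrow>
     (('s1, 's2, 'f1, 'f2, 'aL, 'a1, 'a2) history \<Rightarrow> ('aL, 'a1, 'a2) action set) \<Rightarrow>
     (('s1, 's2, 'f1, 'f2, 'aL, 'a1, 'a2) history \<Rightarrow> ('s1, 's2, 'f1, 'f2) state \<Rightarrow>
      ('aL, 'a1, 'a2) action \<Rightarrow> real) \<Rightarrow> real" where
  "enorm G A e = Max {\<bar>e \<zeta> s a\<bar> | \<zeta> s a. \<zeta> \<in> histories G \<and> a \<in> A \<zeta>}"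

definition pdist ::
    "('s1::finite, 's2::finite, 'f1::finite, 'f2::finite, 'aL::finite, 'a1::finite, 'a2::finite) game \<Rightarrow>
     ('s1, 's2, 'f1, 'f2, 'aL, 'a1, 'a2) policy \<Rightarrow>
     ('s1, 's2, 'f1, 'f2, 'aL, 'a1, 'a2) policy \<Rightarrow> real" where
  "pdist G \<delta> \<delta>' =
     (SUP u \<in> {u. bounded (u ` histories G) \<and> hnorm G u \<le> 1}.
        hnorm G (\<lambda>\<zeta>. expect_next G \<delta> \<zeta> (acc G u \<zeta>) - expect_next G \<delta>' \<zeta> (acc G u \<zeta>)))"

end

theory Submission
  imports Defs
begin

text \<open>
  With \<open>h\<close> the distance of the negative vector \<open>\<alpha>\<^sup>1\<^sup>,\<^sup>0\<close> of \<open>\<delta>\<^sup>*\<close> from \<open>0\<close>, the function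
  \<open>v = \<alpha>\<^sup>1\<^sup>,\<^sup>0 + h\<close> is nonpositive.  The condition of the theorem makes \<open>v\<close> a supersolution of the
  equation for the coefficient of \<open>\<delta>\<close>, so the maximum principle for the \<open>\<beta>\<close>-contraction \<open>\<Lambda>\<close>
  bounds that coefficient by \<open>v\<close>.
\<close>

section \<open>Linearity, monotonicity and support of the one-step expectation\<close>

lemma expect_next_diff:
  "expect_next G \<delta> \<zeta> (\<lambda>s a. F s a - F' s a) = expect_next G \<delta> \<zeta> F - expect_next G \<delta> \<zeta> F'"
  by (simp add: expect_next_def right_diff_distrib sum_subtractf)

lemma expect_next_add:
  "expect_next G \<delta> \<zeta> (\<lambda>s a. F s a + F' s a) = expect_next G \<delta> \<zeta> F + expect_next G \<delta> \<zeta> F'"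
  by (simp add: expect_next_def distrib_left sum.distrib)

lemma expect_next_cmult: "expect_next G \<delta> \<zeta> (\<lambda>s a. c * F s a) = c * expect_next G \<delta> \<zeta> F"
  by (simp add: expect_next_def sum_distrib_left mult.left_commute)

text \<open>Actions outside the support carry weight zero. This matches \<open>enorm\<close>, which
  controls an expression only on a given set of actions.\<close>

lemma expect_next_cong:
  assumes "\<And>s a. a \<in> set_pmf (act \<delta> \<zeta>) \<Longrightarrow> F s a = F' s a"
  shows "expect_next G \<delta> \<zeta> F = expect_next G \<delta> \<zeta> F'"
  unfolding expect_next_def
proof (rule sum.cong)
  fix a
  show "pmf (act \<delta> \<zeta>) a * (\<Sum>s'\<in>UNIV. pmf (trans G (cur_state \<zeta>) a) s' * F s' a) =
        pmf (act \<delta> \<zeta>) a * (\<Sum>s'\<in>UNIV. pmf (trans G (cur_state \<zeta>) a) s' * F' s' a)"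
    using assms by (cases "a \<in> set_pmf (act \<delta> \<zeta>)") (simp_all add: set_pmf_iff)
qed simp

lemma expect_next_const: "expect_next G \<delta> \<zeta> (\<lambda>s a. c) = c"
proof -
  have pmf1: "(\<Sum>x\<in>UNIV. pmf p x) = 1" for p :: "'x::finite pmf"
    by (rule sum_pmf_eq_1) auto
  show ?thesis
    by (simp add: expect_next_def pmf1 flip: sum_distrib_right)
qed

lemma expect_next_mono:
  assumes "\<And>s a. F s a \<le> F' s a"
  shows "expect_next G \<delta> \<zeta> F \<le> expect_next G \<delta> \<zeta> F'"
  unfolding expect_next_def by (intro sum_mono mult_left_mono assms pmf_nonneg)

lemma expect_next_le:
  assumes "\<And>s a. a \<in> set_pmf (act \<delta> \<zeta>) \<Longrightarrow> F s a \<le> c"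
  shows "expect_next G \<delta> \<zeta> F \<le> c"
proof -
  \<comment> \<open>\<open>F\<close> is unconstrained at actions of probability zero, so it is
    replaced there by the target bound before monotonicity applies.\<close>
  have "expect_next G \<delta> \<zeta> F =
      expect_next G \<delta> \<zeta> (\<lambda>s a. if a \<in> set_pmf (act \<delta> \<zeta>) then F s a else c)"
    by (rule expect_next_cong) simp
  also have "\<dots> \<le> expect_next G \<delta> \<zeta> (\<lambda>s a. c)"
    by (rule expect_next_mono) (simp add: assms)
  finally show ?thesis by (simp add: expect_next_const)
qed

section \<open>Fixed points of \<open>Lam\<close> and the maximum principle\<close>

lemma Lam_solution_eq:
  assumes "wf_game G" "\<zeta> \<in> histories G"
  shows "Lam_solution G \<delta> g \<zeta> = g \<zeta> + Lam G \<delta> (Lam_solution G \<delta> g) \<zeta>"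
  using theI'[OF Lam_fixpoint_ex1[OF assms(1), of g \<delta>]] assms(2)
  unfolding Lam_solution_def by blast

lemma Lam_add_const: "Lam G \<delta> (\<lambda>\<xi>. f \<xi> + c) \<zeta> = Lam G \<delta> f \<zeta> + discount G * c"
proof -
  have "acc G (\<lambda>\<xi>. f \<xi> + c) \<zeta> = (\<lambda>s a. acc G f \<zeta> s a + c)"
    by (simp add: acc_def fun_eq_iff)
  then show ?thesis
    by (simp add: Lam_def expect_next_add expect_next_const distrib_left)
qed

lemma Lam_le:
  assumes "wf_game G" "\<zeta> \<in> histories G" "\<And>\<xi>. \<xi> \<in> histories G \<Longrightarrow> f \<xi> \<le> c"
  shows "Lam G \<delta> f \<zeta> \<le> discount G * c"
  using assms(1) unfolding Lam_def wf_game_def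
  by (intro mult_left_mono expect_next_le) (auto simp: acc_def assms upd_in_histories)

text \<open>At a history where the solution minus \<open>v\<close> attains its maximum
  \<open>m\<close>, subtracting the inequality from the equation bounds \<open>m\<close> by
  \<open>Lam\<close> of the difference, hence by \<open>discount G * m\<close>. As the discount is
  below 1, \<open>m\<close> cannot be positive.\<close>

lemma Lam_solution_le_supersolution:
  assumes wf: "wf_game G"
    and super: "\<And>\<xi>. \<xi> \<in> histories G \<Longrightarrow> g \<xi> + Lam G \<delta> v \<xi> \<le> v \<xi>"
    and \<zeta>: "\<zeta> \<in> histories G"
  shows "Lam_solution G \<delta> g \<zeta> \<le> v \<zeta>"
proof -
  let ?f = "Lam_solution G \<delta> g" and ?H = "histories G"
  define m where "m = Max ((\<lambda>\<xi>. ?f \<xi> - v \<xi>) ` ?H)"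
  have m: "?f \<xi> - v \<xi> \<le> m" if "\<xi> \<in> ?H" for \<xi>
    unfolding m_def using that by (intro Max_ge finite_imageI finite_histories imageI)
  have "m \<in> (\<lambda>\<xi>. ?f \<xi> - v \<xi>) ` ?H"
    unfolding m_def by (intro Max_in) (simp_all add: finite_histories histories_nonempty)
  then obtain \<xi> where \<xi>: "\<xi> \<in> ?H" "m = ?f \<xi> - v \<xi>" by auto
  have "m \<le> Lam G \<delta> (\<lambda>\<xi>. ?f \<xi> - v \<xi>) \<xi>"
    using Lam_solution_eq[OF wf \<xi>(1), of \<delta> g] super[OF \<xi>(1)] \<xi>(2) by (simp add: Lam_diff)
  also have "\<dots> \<le> discount G * m"
    by (rule Lam_le[OF wf \<xi>(1) m])
  finally have "(1 - discount G) * m \<le> 0" by (simp add: algebra_simps)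
  then have "m \<le> 0" using wf by (simp add: wf_game_def mult_le_0_iff)
  then show ?thesis using m[OF \<zeta>] by simp
qed

section \<open>The norms and the distance of policies\<close>

lemma abs_le_hnorm:
  fixes G :: "('s1::finite, 's2::finite, 'f1::finite, 'f2::finite, 'aL::finite, 'a1::finite, 'a2::finite) game"
  assumes "\<zeta> \<in> histories G"
  shows "\<bar>u \<zeta>\<bar> \<le> hnorm G u"
  unfolding hnorm_def using assms by (intro Max_ge finite_imageI finite_histories imageI)

lemma hnorm_leI:
  fixes G :: "('s1::finite, 's2::finite, 'f1::finite, 'f2::finite, 'aL::finite, 'a1::finite, 'a2::finite) game"
  assumes "\<And>\<zeta>. \<zeta> \<in> histories G \<Longrightarrow> \<bar>u \<zeta>\<bar> \<le> c"
  shows "hnorm G u \<le> c"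
  unfolding hnorm_def
  using assms by (subst Max_le_iff) (auto simp: finite_histories histories_nonempty)

lemma abs_le_enorm:
  fixes G :: "('s1::finite, 's2::finite, 'f1::finite, 'f2::finite, 'aL::finite, 'a1::finite, 'a2::finite) game"
  assumes "\<zeta> \<in> histories G" "a \<in> A \<zeta>"
  shows "\<bar>e \<zeta> s a\<bar> \<le> enorm G A e"
  unfolding enorm_def
proof (rule Max_ge)
  \<comment> \<open>\<open>Max_ge\<close> needs a finite set; dropping the restriction on actions
    gives a finite image that contains it.\<close>
  have "{\<bar>e \<zeta> s a\<bar> | \<zeta> s a. \<zeta> \<in> histories G \<and> a \<in> A \<zeta>} \<subseteq>
      (\<lambda>(\<zeta>, s, a). \<bar>e \<zeta> s a\<bar>) ` (histories G \<times> UNIV \<times> UNIV)"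
  proof clarify
    fix \<zeta> s a assume "\<zeta> \<in> histories G"
    then show "\<bar>e \<zeta> s a\<bar> \<in> (\<lambda>(\<zeta>, s, a). \<bar>e \<zeta> s a\<bar>) ` (histories G \<times> UNIV \<times> UNIV)"
      by (intro image_eqI[where x = "(\<zeta>, s, a)"]) simp_all
  qed
  then show "finite {\<bar>e \<zeta> s a\<bar> | \<zeta> s a. \<zeta> \<in> histories G \<and> a \<in> A \<zeta>}"
    by (rule finite_subset) (intro finite_imageI finite_cartesian_product finite_histories finite)
qed (use assms in blast)

text \<open>The function \<open>u\<close> is a competitor in the supremum \<open>pdist\<close>. A
  real supremum dominates its members once the family is bounded above, which is the point to
  check.\<close>

lemma expect_next_diff_le_pdist_unit:
  assumes \<zeta>: "\<zeta> \<in> histories G" and u: "\<And>\<xi>. \<xi> \<in> histories G \<Longrightarrow> \<bar>u \<xi>\<bar> \<le> 1"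
  shows "expect_next G \<delta> \<zeta> (acc G u \<zeta>) - expect_next G \<delta>' \<zeta> (acc G u \<zeta>) \<le> pdist G \<delta> \<delta>'"
proof -
  let ?D = "\<lambda>u \<zeta>. expect_next G \<delta> \<zeta> (acc G u \<zeta>) - expect_next G \<delta>' \<zeta> (acc G u \<zeta>)"
  let ?U = "{u. bounded (u ` histories G) \<and> hnorm G u \<le> 1}"
  \<comment> \<open>Both expectations average values in [-1, 1], so their difference is at most 2 in
    absolute value.\<close>
  have le2: "hnorm G (?D w) \<le> 2" if "w \<in> ?U" for w
  proof (rule hnorm_leI)
    fix \<xi> assume \<xi>: "\<xi> \<in> histories G"
    have "\<bar>acc G w \<xi> s a\<bar> \<le> 1" for s a
      unfolding acc_def
      by (rule order_trans[OF abs_le_hnorm[OF upd_in_histories[OF \<xi>]]]) (use that in simp)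
    then have "\<bar>expect_next G \<gamma> \<xi> (acc G w \<xi>)\<bar> \<le> 1" for \<gamma>
      by (rule abs_expect_next_le)
    from this[of \<delta>] this[of \<delta>'] show "\<bar>?D w \<xi>\<bar> \<le> 2" by linarith
  qed
  have "u \<in> ?U"
    by (simp add: hnorm_leI[OF u] finite_imp_bounded finite_histories)
  then have "hnorm G (?D u) \<le> pdist G \<delta> \<delta>'"
    unfolding pdist_def by (rule cSUP_upper) (rule bdd_aboveI2[OF le2])
  then show ?thesis
    using abs_le_hnorm[OF \<zeta>, of "?D u"] by linarith
qed

text \<open>Both expectations are homogeneous in \<open>u\<close>, so division by \<open>c\<close>
  reduces to the unit ball.\<close>

lemma expect_next_diff_le_pdist:
  assumes \<zeta>: "\<zeta> \<in> histories G" and u: "\<And>\<xi>. \<xi> \<in> histories G \<Longrightarrow> \<bar>u \<xi>\<bar> \<le> c"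
  shows "expect_next G \<delta> \<zeta> (acc G u \<zeta>) - expect_next G \<delta>' \<zeta> (acc G u \<zeta>) \<le> pdist G \<delta> \<delta>' * c"
\<comment> \<open>Division by \<open>c\<close> fails at 0, but there \<open>u\<close> vanishes on
  all histories.\<close>
proof (cases "c = 0")
  case True
  then have "acc G u \<zeta> = (\<lambda>s a. 0)"
    using u \<zeta> by (simp add: acc_def fun_eq_iff upd_in_histories)
  then show ?thesis using True by (simp add: expect_next_const)
next
  case False
  then have c: "c > 0" using u[OF \<zeta>] by linarith
  define w where "w \<xi> = u \<xi> / c" for \<xi>
  have "acc G u \<zeta> = (\<lambda>s a. c * acc G w \<zeta> s a)"
    using c by (simp add: acc_def w_def fun_eq_iff)
  then have "expect_next G \<delta> \<zeta> (acc G u \<zeta>) - expect_next G \<delta>' \<zeta> (acc G u \<zeta>) =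
      (expect_next G \<delta> \<zeta> (acc G w \<zeta>) - expect_next G \<delta>' \<zeta> (acc G w \<zeta>)) * c"
    by (simp add: expect_next_cmult algebra_simps)
  also have "\<dots> \<le> pdist G \<delta> \<delta>' * c"
    using c u by (intro mult_right_mono expect_next_diff_le_pdist_unit[OF \<zeta>]) (simp_all add: w_def)
  finally show ?thesis .
qed

text \<open>
  For \<open>\<zeta>\<close> fixed, an expression in the next state and the action is the value at the accurately
  updated history of a function that reads them off its most recent entry.  Setting this
  function to \<open>0\<close> at the actions neither policy takes keeps it within the norm.
\<close>

lemma expect_next_diff_le_pdist_enorm:
  fixes G :: "('s1::finite, 's2::finite, 'f1::finite, 'f2::finite, 'aL::finite, 'a1::finite, 'a2::finite) game"
  assumes wf: "wf_game G" and \<zeta>: "\<zeta> \<in> histories G"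
  shows "expect_next G \<delta> \<zeta> (e \<zeta>) - expect_next G \<delta>' \<zeta> (e \<zeta>)
    \<le> pdist G \<delta> \<delta>' * enorm G (\<lambda>\<zeta>. set_pmf (act \<delta>' \<zeta>) \<union> set_pmf (act \<delta> \<zeta>)) e"
proof -
  let ?A = "\<lambda>\<zeta>. set_pmf (act \<delta>' \<zeta>) \<union> set_pmf (act \<delta> \<zeta>)"
  define u where "u \<xi> = (case hd \<xi> of (s, _, _, a) \<Rightarrow> if a \<in> ?A \<zeta> then e \<zeta> s a else 0)"
    for \<xi> :: "('s1, 's2, 'f1, 'f2, 'aL, 'a1, 'a2) history"
  \<comment> \<open>A positive memory length keeps the new entry at the head of the updated history,
    where \<open>u\<close> reads it.\<close>
  obtain n where n: "memlen G = Suc n"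
    using wf by (cases "memlen G") (auto simp: wf_game_def)
  have acc_u: "acc G u \<zeta> s a = e \<zeta> s a" if "a \<in> ?A \<zeta>" for s a
    using that by (auto simp: acc_def u_def upd_def n)
  \<comment> \<open>The default value 0 of \<open>u\<close> obeys the bound because the norm is
    nonnegative; any action in the nonempty support witnesses this.\<close>
  obtain a0 where "a0 \<in> ?A \<zeta>" using set_pmf_not_empty by fast
  then have "0 \<le> enorm G ?A e"
    using abs_le_enorm[OF \<zeta>, of a0 ?A e] by (meson abs_ge_zero order_trans)
  then have u: "\<bar>u \<xi>\<bar> \<le> enorm G ?A e" for \<xi>
    using abs_le_enorm[OF \<zeta>, of _ ?A e] by (simp add: u_def split: prod.split)
  have "expect_next G \<delta> \<zeta> (e \<zeta>) = expect_next G \<delta> \<zeta> (acc G u \<zeta>)"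
    "expect_next G \<delta>' \<zeta> (e \<zeta>) = expect_next G \<delta>' \<zeta> (acc G u \<zeta>)"
    by (rule expect_next_cong; simp add: acc_u)+
  then show ?thesis
    using expect_next_diff_le_pdist[OF \<zeta> u] by simp
qed

section \<open>Perturbation estimate for a first-order coefficient\<close>

text \<open>The followers enter symmetrically, so one argument serves both: \<open>J\<close> stands
  for \<open>inacc1\<close> or \<open>inacc2\<close>, and \<open>ps\<close>, \<open>p\<close> for
  the zeroth-order coefficients of \<open>\<delta>s\<close> and \<open>\<delta>\<close>.\<close>

lemma first_order_coefficient_nonpos:
  fixes G :: "('s1::finite, 's2::finite, 'f1::finite, 'f2::finite, 'aL::finite, 'a1::finite, 'a2::finite) game"
    and J :: "(('s1, 's2, 'f1, 'f2, 'aL, 'a1, 'a2) history \<Rightarrow> real) \<Rightarrow>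
      ('s1, 's2, 'f1, 'f2, 'aL, 'a1, 'a2) history \<Rightarrow> ('s1, 's2, 'f1, 'f2) state \<Rightarrow>
      ('aL, 'a1, 'a2) action \<Rightarrow> real"
    and ps p :: "('s1, 's2, 'f1, 'f2, 'aL, 'a1, 'a2) history \<Rightarrow> real"
    and \<delta>s \<delta> :: "('s1, 's2, 'f1, 'f2, 'aL, 'a1, 'a2) policy"
  defines "D \<equiv> \<lambda>\<gamma> f \<zeta>. - Lam G \<gamma> f \<zeta> + discount G * expect_next G \<gamma> \<zeta> (J f \<zeta>)"
  defines "x \<equiv> Lam_solution G \<delta>s (D \<delta>s ps)"
  assumes wf: "wf_game G"
    and J_diff: "\<And>f g \<zeta> s a. J (\<lambda>\<xi>. f \<xi> - g \<xi>) \<zeta> s a = J f \<zeta> s a - J g \<zeta> s a"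
    and neg: "\<forall>\<zeta>\<in>histories G. x \<zeta> < 0"
    and cond: "pdist G \<delta> \<delta>s * (hnorm G x +
          enorm G (\<lambda>\<zeta>. set_pmf (act \<delta>s \<zeta>) \<union> set_pmf (act \<delta> \<zeta>))
            (\<lambda>\<zeta> s a. J ps \<zeta> s a - acc G ps \<zeta> s a))
        + enorm G (\<lambda>\<zeta>. set_pmf (act \<delta> \<zeta>)) (J (\<lambda>\<xi>. ps \<xi> - p \<xi>))
        + enorm G (\<lambda>\<zeta>. set_pmf (act \<delta> \<zeta>)) (\<lambda>\<zeta> s a. acc G ps \<zeta> s a - acc G p \<zeta> s a)
        \<le> (1 - discount G) / discount G * \<bar>Max (x ` histories G)\<bar>"
    and \<zeta>: "\<zeta> \<in> histories G"
  shows "Lam_solution G \<delta> (D \<delta> p) \<zeta> \<le> 0"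
proof -
  let ?b = "discount G" and ?H = "histories G"
  let ?E = "expect_next G"
  let ?A = "\<lambda>\<zeta>. set_pmf (act \<delta>s \<zeta>) \<union> set_pmf (act \<delta> \<zeta>)"
  let ?B = "\<lambda>\<zeta>. set_pmf (act \<delta> \<zeta>)"
  let ?e = "\<lambda>\<zeta> s a. J ps \<zeta> s a - acc G ps \<zeta> s a"
  let ?q = "\<lambda>\<zeta> s a. acc G ps \<zeta> s a - acc G p \<zeta> s a"
  define h where "h = \<bar>Max (x ` ?H)\<bar>"
  have b: "0 < ?b" using wf by (simp add: wf_game_def)
  have "Max (x ` ?H) < 0"
    using neg by (subst Max_less_iff) (simp_all add: finite_histories histories_nonempty)
  \<comment> \<open>The maximum is negative, so \<open>h\<close> is minus the maximum and the shift
    by \<open>h\<close> moves it to exactly 0.\<close>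
  then have x_le: "x \<xi> + h \<le> 0" if "\<xi> \<in> ?H" for \<xi>
    using Max_ge[OF finite_imageI[OF finite_histories] imageI[OF that], of x] by (simp add: h_def)
  have "Lam_solution G \<delta> (D \<delta> p) \<zeta> \<le> x \<zeta> + h"
  proof (rule Lam_solution_le_supersolution[OF wf _ \<zeta>])
    fix \<xi> assume \<xi>: "\<xi> \<in> ?H"
    have x_eq: "x \<xi> = D \<delta>s ps \<xi> + Lam G \<delta>s x \<xi>"
      unfolding x_def by (rule Lam_solution_eq[OF wf \<xi>])
    \<comment> \<open>Passing from \<open>\<delta>s\<close> to \<open>\<delta>\<close> causes three
      errors: the change of policy in the \<open>Lam\<close> term (\<open>1\<close>), the change of
      policy in the source term (\<open>2\<close>), and the replacement of \<open>ps\<close> by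
      \<open>p\<close> under \<open>\<delta>\<close> (\<open>3\<close>).\<close>
    have 1: "?E \<delta> \<xi> (acc G x \<xi>) - ?E \<delta>s \<xi> (acc G x \<xi>) \<le> pdist G \<delta> \<delta>s * hnorm G x"
      by (rule expect_next_diff_le_pdist[OF \<xi> abs_le_hnorm])
    have 2: "?E \<delta> \<xi> (?e \<xi>) - ?E \<delta>s \<xi> (?e \<xi>) \<le> pdist G \<delta> \<delta>s * enorm G ?A ?e"
      by (rule expect_next_diff_le_pdist_enorm[OF wf \<xi>, of \<delta> ?e])
    have 3: "?E \<delta> \<xi> (\<lambda>s a. ?q \<xi> s a - J (\<lambda>\<xi>. ps \<xi> - p \<xi>) \<xi> s a)
        \<le> enorm G ?B (J (\<lambda>\<xi>. ps \<xi> - p \<xi>)) + enorm G ?B ?q"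
    proof (rule expect_next_le)
      fix s a assume a: "a \<in> ?B \<xi>"
      show "?q \<xi> s a - J (\<lambda>\<xi>. ps \<xi> - p \<xi>) \<xi> s a
          \<le> enorm G ?B (J (\<lambda>\<xi>. ps \<xi> - p \<xi>)) + enorm G ?B ?q"
        using abs_le_enorm[of \<xi> G a ?B "J (\<lambda>\<xi>. ps \<xi> - p \<xi>)" s]
          abs_le_enorm[of \<xi> G a ?B ?q s] \<xi> a by linarith
    qed
    have "?E \<delta> \<xi> (acc G x \<xi>) - ?E \<delta>s \<xi> (acc G x \<xi>) + (?E \<delta> \<xi> (?e \<xi>) - ?E \<delta>s \<xi> (?e \<xi>))
        + ?E \<delta> \<xi> (\<lambda>s a. ?q \<xi> s a - J (\<lambda>\<xi>. ps \<xi> - p \<xi>) \<xi> s a) \<le> (1 - ?b) / ?b * h"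
      using 1 2 3 cond by (simp add: distrib_left h_def)
    then have "?b * (?E \<delta> \<xi> (acc G x \<xi>) - ?E \<delta>s \<xi> (acc G x \<xi>) + (?E \<delta> \<xi> (?e \<xi>) - ?E \<delta>s \<xi> (?e \<xi>))
        + ?E \<delta> \<xi> (\<lambda>s a. ?q \<xi> s a - J (\<lambda>\<xi>. ps \<xi> - p \<xi>) \<xi> s a)) \<le> (1 - ?b) * h"
      using b by (simp add: field_simps)
    \<comment> \<open>The sum telescopes: the expectations under \<open>\<delta>s\<close> rebuild
      \<open>x\<close> through its equation, and under \<open>\<delta>\<close> the contributions of
      \<open>ps\<close> cancel, leaving those of \<open>p\<close> and \<open>x\<close>.\<close>
    then have "D \<delta> p \<xi> + Lam G \<delta> x \<xi> - x \<xi> \<le> (1 - ?b) * h"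
      by (subst x_eq) (simp add: D_def Lam_def J_diff expect_next_diff expect_next_add algebra_simps)
    \<comment> \<open>Adding \<open>h\<close> raises the \<open>Lam\<close> term by
      \<open>?b * h\<close> only, and the gap to \<open>h\<close> is exactly the error
      allowed.\<close>
    then show "D \<delta> p \<xi> + Lam G \<delta> (\<lambda>\<xi>. x \<xi> + h) \<xi> \<le> x \<xi> + h"
      unfolding Lam_add_const by (simp add: algebra_simps)
  qed
  with x_le[OF \<zeta>] show ?thesis by linarith
qed

text \<open>\<open>Del1\<close> occurs without its history argument in \<open>alpha10_def\<close>;
  an equation between functions rewrites it there into the shape of \<open>D\<close> with
  \<open>J\<close> as \<open>inacc1 G\<close>.\<close>

lemma Del1_eq: "Del1 G = (\<lambda>\<gamma> f \<zeta>. - Lam G \<gamma> f \<zeta> + discount G * expect_next G \<gamma> \<zeta> (inacc1 G f \<zeta>))"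
  by (simp add: fun_eq_iff Del1_def)

lemma Del2_eq: "Del2 G = (\<lambda>\<gamma> f \<zeta>. - Lam G \<gamma> f \<zeta> + discount G * expect_next G \<gamma> \<zeta> (inacc2 G f \<zeta>))"
  by (simp add: fun_eq_iff Del2_def)

lemma inacc1_diff: "inacc1 G (\<lambda>\<xi>. f \<xi> - g \<xi>) \<zeta> s a = inacc1 G f \<zeta> s a - inacc1 G g \<zeta> s a"
  by (simp add: inacc1_def right_diff_distrib sum_subtractf)

lemma inacc2_diff: "inacc2 G (\<lambda>\<xi>. f \<xi> - g \<xi>) \<zeta> s a = inacc2 G f \<zeta> s a - inacc2 G g \<zeta> s a"
  by (simp add: inacc2_def right_diff_distrib sum_subtractf)

theorem theorem2:
  fixes G :: "('s1::finite, 's2::finite, 'f1::finite, 'f2::finite, 'aL::finite, 'a1::finite, 'a2::finite) game"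
    and rs r :: "('s1, 's2, 'f1, 'f2, 'aL, 'a1, 'a2) reward_structure"
    and \<delta>s \<delta> :: "('s1, 's2, 'f1, 'f2, 'aL, 'a1, 'a2) policy"
    and h1 h2 \<eta>1 \<eta>2 :: real
  assumes game: "wf_game G"
    and neg10: "\<forall>\<zeta>\<in>histories G. alpha10 G rs \<delta>s \<zeta> < 0"
    and neg01: "\<forall>\<zeta>\<in>histories G. alpha01 G rs \<delta>s \<zeta> < 0"
    and h1: "h1 = \<bar>Max (alpha10 G rs \<delta>s ` histories G)\<bar>"
    and h2: "h2 = \<bar>Max (alpha01 G rs \<delta>s ` histories G)\<bar>"
    and \<eta>1: "\<eta>1 = hnorm G (alpha10 G rs \<delta>s) +
        enorm G (\<lambda>\<zeta>. set_pmf (act \<delta>s \<zeta>) \<union> set_pmf (act \<delta> \<zeta>))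
          (\<lambda>\<zeta> s a. inacc1 G (alpha00 G rs \<delta>s) \<zeta> s a - acc G (alpha00 G rs \<delta>s) \<zeta> s a)"
    and \<eta>2: "\<eta>2 = hnorm G (alpha01 G rs \<delta>s) +
        enorm G (\<lambda>\<zeta>. set_pmf (act \<delta>s \<zeta>) \<union> set_pmf (act \<delta> \<zeta>))
          (\<lambda>\<zeta> s a. inacc2 G (alpha00 G rs \<delta>s) \<zeta> s a - acc G (alpha00 G rs \<delta>s) \<zeta> s a)"
    and cond1: "pdist G \<delta> \<delta>s * \<eta>1
        + enorm G (\<lambda>\<zeta>. set_pmf (act \<delta> \<zeta>))
            (inacc1 G (\<lambda>\<zeta>'. alpha00 G rs \<delta>s \<zeta>' - alpha00 G r \<delta> \<zeta>'))
        + enorm G (\<lambda>\<zeta>. set_pmf (act \<delta> \<zeta>))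
            (\<lambda>\<zeta> s a. acc G (alpha00 G rs \<delta>s) \<zeta> s a - acc G (alpha00 G r \<delta>) \<zeta> s a)
        \<le> (1 - discount G) / discount G * h1"
    and cond2: "pdist G \<delta> \<delta>s * \<eta>2
        + enorm G (\<lambda>\<zeta>. set_pmf (act \<delta> \<zeta>))
            (inacc2 G (\<lambda>\<zeta>'. alpha00 G rs \<delta>s \<zeta>' - alpha00 G r \<delta> \<zeta>'))
        + enorm G (\<lambda>\<zeta>. set_pmf (act \<delta> \<zeta>))
            (\<lambda>\<zeta> s a. acc G (alpha00 G rs \<delta>s) \<zeta> s a - acc G (alpha00 G r \<delta>) \<zeta> s a)
        \<le> (1 - discount G) / discount G * h2"
  shows "\<forall>\<zeta>\<in>histories G. alpha10 G r \<delta> \<zeta> \<le> 0 \<and> alpha01 G r \<delta> \<zeta> \<le> 0"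
proof (intro ballI conjI)
  fix \<zeta> assume \<zeta>: "\<zeta> \<in> histories G"
  show "alpha10 G r \<delta> \<zeta> \<le> 0"
    using neg10 cond1 unfolding alpha10_def Del1_eq h1 \<eta>1
    by (rule first_order_coefficient_nonpos[where J = "inacc1 G", OF game inacc1_diff _ _ \<zeta>])
  show "alpha01 G r \<delta> \<zeta> \<le> 0"
    using neg01 cond2 unfolding alpha01_def Del2_eq h2 \<eta>2
    by (rule first_order_coefficient_nonpos[where J = "inacc2 G", OF game inacc2_diff _ _ \<zeta>])
qed

end
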